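(* Let $\mu$ be an LJSD. In the ridgeless limit $\gamma\to0$ and in the overparameterized regime $\psi<\phi$, the limiting variance $V_\mu$ of random feature regression is a nonincreasing function of the overparameterization ratio $\phi/\psi$ (where $\phi$, $\mu$, $\sigma$, $\sigma_\varepsilon^2$ are held fixed and $\psi\in(0,\phi)$ varies).
   Context: Parameters: $\phi>0$, $0<\psi<\phi$, label noise $\sigma_\varepsilon^2\ge0$. Activation $\sigma:\mathbb{R}\to\mathbb{R}$, differentiable almost everywhere with $|\sigma(u)|,|\sigma'(u)|\le c_0e^{c_1|u|}$. LJSD: a limiting joint spectral distribution is a probability measure $\mu$ on $\mathbb{R}_+^2$, the law of a pair $(\lambda,r)$ (training eigenvalue, overlap coefficient of the test covariance), supported in $[0,C]^2$ for some $C$, either absolutely continuous or a finite sum of delta masses; $s=\mathbb{E}_\mu[\lambda]$ and $s_*=\mathbb{E}_\mu[r]$ are finite and positive. Constants: with $z\sim\mathcal N(0,s)$, $\eta=\mathbb{V}[\sigma(z)]$, $\rho=(\frac1s\mathbb{E}[z\sigma(z)])^2$, $\zeta=s\rho$, $\omega=s(\eta/\zeta-1)$ (assumed well defined); $(\eta_*,\rho_*,\zeta_*,\omega_* )$ are the same with $s$ replaced by $s_*$; $\xi=\sqrt{\rho_*/\rho}$. Functionals: $\mathcal{I}_{a,b}(x)=\phi\,\mathbb{E}_\mu[\lambda^a(\phi+x\lambda)^{-b}]$, $\mathcal{I}^*_{a,b}(x)=\phi\,\mathbb{E}_\mu[r\lambda^{a-1}(\phi+x\lambda)^{-b}]$.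 Ridgeless limiting variance for $\psi<\phi$: with $x$ the unique positive real root of $x=1/(\omega+\mathcal{I}_{1,1}(x))$ and all functionals evaluated at $x$, $$V_\mu=\xi^2\frac{\psi}{\phi-\psi}x(\sigma_\varepsilon^2+\mathcal{I}_{1,1})(\omega_*+\mathcal{I}^*_{1,1})+\xi^2x\Big(1-\frac{x(\omega-\sigma_\varepsilon^2)}{1-x^2\mathcal{I}_{2,2}}\Big)\mathcal{I}^*_{2,2}.$$ (Here $\phi=\lim n_0/m$, $\psi=\lim n_0/n_1$ for input dimension $n_0$, sample size $m$, number of random features $n_1$.) *)

theory Defs
  imports "HOL-Probability.Probability"
begin

text \<open>
  A point of the plane is a pair \<open>(\<lambda>, r)\<close> of a training eigenvalue and an overlap coefficient;
  in the formulas below \<open>fst p\<close> is \<open>\<lambda>\<close> and \<open>snd p\<close> is \<open>r\<close>.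
\<close>

definition is_finite_sum_of_deltas :: "(real \<times> real) measure \<Rightarrow> bool" where
  "is_finite_sum_of_deltas \<mu> \<longleftrightarrow>
     (\<exists>A w. finite A \<and> (\<forall>B\<in>sets borel. emeasure \<mu> B = (\<Sum>a\<in>A. ennreal (w a) * indicator B a)))"

definition mean_train :: "(real \<times> real) measure \<Rightarrow> real" where
  "mean_train \<mu> = (\<integral>p. fst p \<partial>\<mu>)"

definition mean_test :: "(real \<times> real) measure \<Rightarrow> real" where
  "mean_test \<mu> = (\<integral>p. snd p \<partial>\<mu>)"

text \<open>
  Finiteness of the two means needs no separate clause, since the coordinates are bounded
  almost surely.
\<close>

definition LJSD :: "(real \<times> real) measure \<Rightarrow> bool" where
  "LJSD \<mu> \<longleftrightarrow>
     prob_space \<mu> \<and> sets \<mu> = sets borel \<and>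
     (\<exists>C. AE p in \<mu>. p \<in> {0..C} \<times> {0..C}) \<and>
     (absolutely_continuous lborel \<mu> \<or> is_finite_sum_of_deltas \<mu>) \<and>
     0 < mean_train \<mu> \<and> 0 < mean_test \<mu>"

definition admissible_activation :: "(real \<Rightarrow> real) \<Rightarrow> bool" where
  "admissible_activation \<sigma> \<longleftrightarrow>
     (AE u in lborel. \<sigma> differentiable at u) \<and>
     (\<exists>c0 c1. \<forall>u. \<bar>\<sigma> u\<bar> \<le> c0 * exp (c1 * \<bar>u\<bar>) \<and>
        (\<sigma> differentiable at u \<longrightarrow> \<bar>deriv \<sigma> u\<bar> \<le> c0 * exp (c1 * \<bar>u\<bar>)))"

text \<open>
  The centred normal law with variance \<open>s\<close>. It lives on the Lebesgue (not the Borel) sigma-algebra,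
  because a function that is differentiable almost everywhere is Lebesgue measurable but need not
  be Borel measurable.
\<close>

definition centred_normal :: "real \<Rightarrow> real measure" where
  "centred_normal s = density lebesgue (normal_density 0 (sqrt s))"

definition act_eta :: "(real \<Rightarrow> real) \<Rightarrow> real \<Rightarrow> real" where
  "act_eta \<sigma> s = prob_space.variance (centred_normal s) \<sigma>"

definition act_rho :: "(real \<Rightarrow> real) \<Rightarrow> real \<Rightarrow> real" where
  "act_rho \<sigma> s = (1 / s * (\<integral>z. z * \<sigma> z \<partial>centred_normal s))\<^sup>2"

definition act_zeta :: "(real \<Rightarrow> real) \<Rightarrow> real \<Rightarrow> real" where
  "act_zeta \<sigma> s = s * act_rho \<sigma> s"

definition act_omega :: "(real \<Rightarrow> real) \<Rightarrow> real \<Rightarrow> real" where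
  "act_omega \<sigma> s = s * (act_eta \<sigma> s / act_zeta \<sigma> s - 1)"

definition act_xi :: "(real \<Rightarrow> real) \<Rightarrow> (real \<times> real) measure \<Rightarrow> real" where
  "act_xi \<sigma> \<mu> = sqrt (act_rho \<sigma> (mean_test \<mu>) / act_rho \<sigma> (mean_train \<mu>))"

definition I_fun :: "(real \<times> real) measure \<Rightarrow> real \<Rightarrow> nat \<Rightarrow> nat \<Rightarrow> real \<Rightarrow> real" where
  "I_fun \<mu> \<phi> a b x = \<phi> * (\<integral>p. fst p ^ a / (\<phi> + x * fst p) ^ b \<partial>\<mu>)"

text \<open>The exponent \<open>a - 1\<close> is a truncated difference: the functional is meant for \<open>a \<ge> 1\<close>.\<close>

definition I_star :: "(real \<times> real) measure \<Rightarrow> real \<Rightarrow> nat \<Rightarrow> nat \<Rightarrow> real \<Rightarrow> real" where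
  "I_star \<mu> \<phi> a b x = \<phi> * (\<integral>p. snd p * fst p ^ (a - 1) / (\<phi> + x * fst p) ^ b \<partial>\<mu>)"

definition is_ridgeless_root ::
    "(real \<times> real) measure \<Rightarrow> (real \<Rightarrow> real) \<Rightarrow> real \<Rightarrow> real \<Rightarrow> bool" where
  "is_ridgeless_root \<mu> \<sigma> \<phi> x \<longleftrightarrow>
     0 < x \<and> x = 1 / (act_omega \<sigma> (mean_train \<mu>) + I_fun \<mu> \<phi> 1 1 x)"

text \<open>
  A root exists whenever \<open>\<omega> > 0\<close>. When \<open>\<omega> = 0\<close> (linear activation) it exists only if
  \<open>\<phi> * \<mu> {\<lambda> > 0} > 1\<close>; otherwise the description below denotes no meaningful number.
\<close>

definition ridgeless_root :: "(real \<times> real) measure \<Rightarrow> (real \<Rightarrow> real) \<Rightarrow> real \<Rightarrow> real" where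
  "ridgeless_root \<mu> \<sigma> \<phi> = (THE x. is_ridgeless_root \<mu> \<sigma> \<phi> x)"

text \<open>
  The ridgeless limiting variance for \<open>\<psi> < \<phi>\<close>; the argument \<open>v\<close> is the label noise variance.
\<close>

definition V_ridgeless ::
    "(real \<times> real) measure \<Rightarrow> (real \<Rightarrow> real) \<Rightarrow> real \<Rightarrow> real \<Rightarrow> real \<Rightarrow> real" where
  "V_ridgeless \<mu> \<sigma> v \<phi> \<psi> =
    (let \<omega> = act_omega \<sigma> (mean_train \<mu>);
         \<omega>s = act_omega \<sigma> (mean_test \<mu>);
         \<xi> = act_xi \<sigma> \<mu>;
         x = ridgeless_root \<mu> \<sigma> \<phi>
     in \<xi>\<^sup>2 * (\<psi> / (\<phi> - \<psi>)) * x * (v + I_fun \<mu> \<phi> 1 1 x) * (\<omega>s + I_star \<mu> \<phi> 1 1 x)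
        + \<xi>\<^sup>2 * x * (1 - x * (\<omega> - v) / (1 - x\<^sup>2 * I_fun \<mu> \<phi> 2 2 x)) * I_star \<mu> \<phi> 2 2 x)"

end

theory Submission
  imports Defs
begin

text \<open>
  The root \<open>x\<close> does not involve \<open>\<psi>\<close>, so \<open>V\<close> is an affine function of \<open>\<psi> / (\<phi> - \<psi>)\<close>, which increases
  with \<open>\<psi>\<close>. Its slope is nonnegative because \<open>x > 0\<close> and \<open>\<omega>\<^sub>* \<ge> 0\<close>. The latter says that
  \<open>\<eta> - \<zeta>\<close>, the mean square residual of the linear regression of \<open>\<sigma>(z)\<close> on \<open>z\<close>, is nonnegative.
  That \<open>x\<close> is a genuine positive number rests on the uniqueness of the root, which follows from the strict
  monotonicity of \<open>x (\<omega> + I\<^sub>1\<^sub>,\<^sub>1 x)\<close>.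
\<close>

section \<open>Integrals against the centred normal law\<close>

text \<open>Moments of normal densities are known over \<open>lborel\<close>, while
  \<open>centred_normal\<close> lives on the completion. For a Borel integrand, completing changes
  neither integrability nor the integral, so those facts carry over.\<close>

lemma integrable_centred_normal_iff:
  fixes f :: "real \<Rightarrow> real"
  assumes "f \<in> borel_measurable borel"
  shows "integrable (centred_normal s) f \<longleftrightarrow>
         integrable lborel (\<lambda>u. normal_density 0 (sqrt s) u * f u)"
proof -
  have "f \<in> borel_measurable lebesgue"
    using assms by (simp add: measurable_completion)
  then have "integrable (centred_normal s) f \<longleftrightarrow>
      integrable lebesgue (\<lambda>u. normal_density 0 (sqrt s) u * f u)"
    unfolding centred_normal_def by (subst integrable_real_density) (auto simp: measurable_completion)
  then show ?thesis
    using assms by (simp add: integrable_completion)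
qed

lemma integral_centred_normal:
  fixes f :: "real \<Rightarrow> real"
  assumes "f \<in> borel_measurable borel"
  shows "(\<integral>u. f u \<partial>centred_normal s) = (\<integral>u. normal_density 0 (sqrt s) u * f u \<partial>lborel)"
proof -
  have "f \<in> borel_measurable lebesgue"
    using assms by (simp add: measurable_completion)
  then have "(\<integral>u. f u \<partial>centred_normal s) =
      (\<integral>u. normal_density 0 (sqrt s) u * f u \<partial>lebesgue)"
    unfolding centred_normal_def by (subst integral_real_density) (auto simp: measurable_completion)
  then show ?thesis
    using assms by (simp add: integral_completion)
qed

lemma prob_space_centred_normal:
  assumes "0 < s"
  shows "prob_space (centred_normal s)"
proof
  have "emeasure (centred_normal s) (space (centred_normal s)) =
      (\<integral>\<^sup>+u. ennreal (normal_density 0 (sqrt s) u) \<partial>lebesgue)"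
    unfolding centred_normal_def by (subst emeasure_density) (auto simp: measurable_completion)
  also have "\<dots> = (\<integral>\<^sup>+u. ennreal (normal_density 0 (sqrt s) u) \<partial>lborel)"
    by (rule nn_integral_completion)
  also have "\<dots> = 1"
    using assms by (subst nn_integral_eq_integral) auto
  finally show "emeasure (centred_normal s) (space (centred_normal s)) = 1" .
qed

lemma centred_normal_moments:
  assumes "0 < s"
  shows "integrable (centred_normal s) (\<lambda>z. z)" "(\<integral>z. z \<partial>centred_normal s) = 0"
    and "integrable (centred_normal s) (\<lambda>z. z\<^sup>2)" "(\<integral>z. z\<^sup>2 \<partial>centred_normal s) = s"
proof -
  have r: "0 < sqrt s" using assms by simp
  show "integrable (centred_normal s) (\<lambda>z. z)"
    using integrable_normal_moment[OF r, of 0 1] by (simp add: integrable_centred_normal_iff)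
  show "(\<integral>z. z \<partial>centred_normal s) = 0"
    using integral_normal_moment_odd[OF r, of 0 0] by (simp add: integral_centred_normal)
  show "integrable (centred_normal s) (\<lambda>z. z\<^sup>2)"
    using integrable_normal_moment[OF r, of 0 2] by (simp add: integrable_centred_normal_iff)
  show "(\<integral>z. z\<^sup>2 \<partial>centred_normal s) = s"
    using integral_normal_moment_even[OF r, of 0 1] assms
    by (simp add: integral_centred_normal power2_eq_square numeral_2_eq_2)
qed

text \<open>Completing the square: tilting the density by \<open>exp (c * u)\<close> moves its mean
  to \<open>c * s\<close>, keeps the variance, and multiplies it by the constant
  \<open>exp (c\<^sup>2 * s / 2)\<close>.\<close>

lemma integrable_centred_normal_exp:
  assumes "0 < s"
  shows "integrable (centred_normal s) (\<lambda>z. exp (c * z))"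
proof -
  have r: "0 < sqrt s" using assms by simp
  have "normal_density 0 (sqrt s) u * exp (c * u) =
      exp (c\<^sup>2 * s / 2) * normal_density (c * s) (sqrt s) u" for u
  proof -
    have "- u\<^sup>2 / (2 * s) + c * u = c\<^sup>2 * s / 2 + - (u - c * s)\<^sup>2 / (2 * s)"
      using assms by (simp add: divide_simps) (simp add: power2_eq_square algebra_simps)
    then have "exp (- u\<^sup>2 / (2 * s)) * exp (c * u) = exp (c\<^sup>2 * s / 2) * exp (- (u - c * s)\<^sup>2 / (2 * s))"
      by (simp only: flip: exp_add)
    then show ?thesis
      using assms by (simp add: normal_density_def)
  qed
  then show ?thesis
    using integrable_normal_density[OF r, of "c * s"]
    by (simp add: integrable_centred_normal_iff)
qed

lemma integrable_centred_normal_exp_abs: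
  assumes "0 < s"
  shows "integrable (centred_normal s) (\<lambda>z. exp (c * \<bar>z\<bar>))"
proof (rule Bochner_Integration.integrable_bound)
  \<comment> \<open>One of the two positive summands equals \<open>exp (c * \<bar>z\<bar>)\<close>,
    according to the sign of \<open>z\<close>.\<close>
  show "integrable (centred_normal s) (\<lambda>z. exp (c * z) + exp ((- c) * z))"
    using assms by (intro Bochner_Integration.integrable_add integrable_centred_normal_exp)
  show "(\<lambda>z. exp (c * \<bar>z\<bar>)) \<in> borel_measurable (centred_normal s)"
    by (auto simp: centred_normal_def measurable_completion)
  show "AE z in centred_normal s. norm (exp (c * \<bar>z\<bar>)) \<le> norm (exp (c * z) + exp (- c * z))"
  proof (intro AE_I2)
    fix z :: real
    have "0 < exp (c * z)" "0 < exp (- c * z)" by (rule exp_gt_zero)+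
    then show "norm (exp (c * \<bar>z\<bar>)) \<le> norm (exp (c * z) + exp (- c * z))"
      by (cases "0 \<le> z") (simp_all add: abs_of_pos)
  qed
qed

section \<open>Nonnegativity of \<omega>\<close>

lemma square_integrable_activation:
  assumes "0 < s" and \<sigma>: "admissible_activation \<sigma>"
    and meas: "\<sigma> \<in> borel_measurable (centred_normal s)"
  shows "integrable (centred_normal s) (\<lambda>z. (\<sigma> z)\<^sup>2)"
proof -
  obtain c0 c1 where c: "\<bar>\<sigma> u\<bar> \<le> c0 * exp (c1 * \<bar>u\<bar>)" for u
    using \<sigma> by (auto simp: admissible_activation_def)
  have bound: "(\<sigma> u)\<^sup>2 \<le> c0\<^sup>2 * exp (2 * c1 * \<bar>u\<bar>)" for u
  proof -
    have "(\<sigma> u)\<^sup>2 = \<bar>\<sigma> u\<bar>\<^sup>2" by simp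
    also have "\<dots> \<le> (c0 * exp (c1 * \<bar>u\<bar>))\<^sup>2"
      by (intro power_mono c abs_ge_zero)
    also have "\<dots> = c0\<^sup>2 * exp (2 * c1 * \<bar>u\<bar>)"
      by (simp add: power_mult_distrib power2_eq_square flip: exp_add)
    finally show ?thesis .
  qed
  show ?thesis
  proof (rule Bochner_Integration.integrable_bound)
    show "integrable (centred_normal s) (\<lambda>z. c0\<^sup>2 * exp (2 * c1 * \<bar>z\<bar>))"
      by (intro integrable_mult_right integrable_centred_normal_exp_abs[OF \<open>0 < s\<close>])
    show "(\<lambda>z. (\<sigma> z)\<^sup>2) \<in> borel_measurable (centred_normal s)"
      by (intro borel_measurable_power meas)
    show "AE z in centred_normal s. norm ((\<sigma> z)\<^sup>2) \<le> norm (c0\<^sup>2 * exp (2 * c1 * \<bar>z\<bar>))"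
      using bound by (intro AE_I2) simp
  qed
qed

text \<open>Here \<open>k\<close> is the least squares slope of \<open>\<sigma> z\<close> on
  \<open>z\<close>, and \<open>act_rho\<close> is its square. Expanding the mean of
  \<open>(\<sigma> z - m - k * z)\<^sup>2\<close>, with mean 0 and variance \<open>s\<close> for
  \<open>z\<close>, leaves exactly \<eta> - \<zeta>.\<close>

lemma act_zeta_le_act_eta:
  assumes s: "0 < s" and \<sigma>: "admissible_activation \<sigma>" and nz: "act_zeta \<sigma> s \<noteq> 0"
  shows "act_zeta \<sigma> s \<le> act_eta \<sigma> s"
proof -
  let ?N = "centred_normal s"
  interpret prob_space ?N by (rule prob_space_centred_normal[OF s])
  define m where "m = expectation \<sigma>"
  define k where "k = 1 / s * (\<integral>z. z * \<sigma> z \<partial>?N)"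
  have z_meas: "(\<lambda>z. z) \<in> borel_measurable ?N"
    by (auto simp: centred_normal_def measurable_completion)
  have z\<sigma>: "integrable ?N (\<lambda>z. z * \<sigma> z)"
    using nz not_integrable_integral_eq by (force simp: act_zeta_def act_rho_def)
  \<comment> \<open>Measurability of \<open>\<sigma>\<close> comes for free: a nonzero Bochner integral has an integrable integrand.\<close>
  have meas: "\<sigma> \<in> borel_measurable ?N"
  proof -
    \<comment> \<open>Dividing by \<open>z\<close> recovers \<open>\<sigma>\<close> except at 0,
      where the quotient defaults to 0; the value \<open>\<sigma> 0\<close> is restored by
      hand.\<close>
    have "(\<lambda>z. if z = 0 then \<sigma> 0 else (z * \<sigma> z) / z) \<in> borel_measurable ?N"
      by (intro measurable_If borel_measurable_divide z_meas borel_measurable_integrable[OF z\<sigma>]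
          borel_measurable_const borel_measurable_eq)
    also have "(\<lambda>z. if z = 0 then \<sigma> 0 else (z * \<sigma> z) / z) = \<sigma>"
      by auto
    finally show ?thesis .
  qed
  have \<sigma>2: "integrable ?N (\<lambda>z. (\<sigma> z)\<^sup>2)"
    by (rule square_integrable_activation[OF s \<sigma> meas])
  have \<sigma>1: "integrable ?N \<sigma>"
    by (rule square_integrable_imp_integrable[OF meas \<sigma>2])
  note [simp] = z\<sigma> \<sigma>2 \<sigma>1 centred_normal_moments[OF s]
  have kz: "(\<integral>z. z * \<sigma> z \<partial>?N) = s * k"
    using s by (simp add: k_def)
  have "0 \<le> (\<integral>z. (\<sigma> z - m - k * z)\<^sup>2 \<partial>?N)"
    by simp
  also have "(\<lambda>z. (\<sigma> z - m - k * z)\<^sup>2) =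
      (\<lambda>z. (\<sigma> z)\<^sup>2 - 2 * m * \<sigma> z + m\<^sup>2 - 2 * k * (z * \<sigma> z) + 2 * k * m * z + k\<^sup>2 * z\<^sup>2)"
    by (auto simp: power2_eq_square algebra_simps)
  also have "(\<integral>z. \<dots> z \<partial>?N) = expectation (\<lambda>z. (\<sigma> z)\<^sup>2) - 2 * m * m + m\<^sup>2 - 2 * k * (s * k) + k\<^sup>2 * s"
    by (simp add: kz prob_space flip: m_def)
  also have "\<dots> = (expectation (\<lambda>z. (\<sigma> z)\<^sup>2) - m\<^sup>2) - s * k\<^sup>2"
    by (simp add: power2_eq_square algebra_simps)
  also have "expectation (\<lambda>z. (\<sigma> z)\<^sup>2) - m\<^sup>2 = act_eta \<sigma> s"
    by (simp add: act_eta_def variance_eq m_def)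
  finally show ?thesis
    by (simp add: act_zeta_def act_rho_def k_def)
qed

lemma act_omega_nonneg:
  assumes s: "0 < s" and \<sigma>: "admissible_activation \<sigma>" and nz: "act_zeta \<sigma> s \<noteq> 0"
  shows "0 \<le> act_omega \<sigma> s"
proof -
  have "0 < act_zeta \<sigma> s"
    using nz s by (simp add: act_zeta_def act_rho_def zero_less_mult_iff)
  then show ?thesis
    using act_zeta_le_act_eta[OF assms] s by (simp add: act_omega_def)
qed

section \<open>The spectral functionals and uniqueness of the root\<close>

lemma LJSD_AE_nonneg:
  assumes "LJSD \<mu>"
  shows "AE p in \<mu>. 0 \<le> fst p" "AE p in \<mu>. 0 \<le> snd p"
proof -
  obtain C where C: "AE p in \<mu>. p \<in> {0..C} \<times> {0..C}"
    using assms by (auto simp: LJSD_def)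
  show "AE p in \<mu>. 0 \<le> fst p" using C by eventually_elim auto
  show "AE p in \<mu>. 0 \<le> snd p" using C by eventually_elim auto
qed

lemma I_fun_nonneg:
  assumes "LJSD \<mu>" "0 < \<phi>" "0 < x"
  shows "0 \<le> I_fun \<mu> \<phi> a b x"
proof -
  have "AE p in \<mu>. 0 \<le> fst p ^ a / (\<phi> + x * fst p) ^ b"
    using LJSD_AE_nonneg(1)[OF assms(1)] by eventually_elim (use assms in simp)
  then show ?thesis
    unfolding I_fun_def using assms(2) by (intro mult_nonneg_nonneg integral_nonneg_AE less_imp_le)
qed

lemma I_star_nonneg:
  assumes "LJSD \<mu>" "0 < \<phi>" "0 < x"
  shows "0 \<le> I_star \<mu> \<phi> a b x"
proof -
  have "AE p in \<mu>. 0 \<le> snd p * fst p ^ (a - 1) / (\<phi> + x * fst p) ^ b"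
    using LJSD_AE_nonneg[OF assms(1)] by eventually_elim (use assms in simp)
  then show ?thesis
    unfolding I_star_def using assms(2) by (intro mult_nonneg_nonneg integral_nonneg_AE less_imp_le)
qed

text \<open>With the factor moved inside, the integrand is \<open>t * l / (\<phi> + t * l)\<close>,
  which increases with \<open>t\<close>. On the bounded support its increment from \<open>x\<close>
  to \<open>y\<close> is at least \<open>c * l\<close> with one constant \<open>c > 0\<close>, so
  strictness follows from the positive mean of \<open>l\<close>.\<close>

lemma mult_I_fun_strict_mono:
  assumes L: "LJSD \<mu>" and "0 < \<phi>" "0 < x" "x < y"
  shows "x * I_fun \<mu> \<phi> 1 1 x < y * I_fun \<mu> \<phi> 1 1 y"
proof -
  interpret prob_space \<mu> using L by (simp add: LJSD_def)
  have sets [measurable_cong]: "sets \<mu> = sets borel" using L by (simp add: LJSD_def)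
  obtain C where C: "AE p in \<mu>. p \<in> {0..C} \<times> {0..C}" using L by (auto simp: LJSD_def)
  have fst_meas [measurable]: "fst \<in> borel_measurable \<mu>"
    unfolding measurable_cong_sets[OF sets refl]
    by (intro borel_measurable_continuous_onI continuous_intros)
  have int: "integrable \<mu> (\<lambda>p. t * fst p / (\<phi> + t * fst p))" if "0 < t" for t
  proof (rule integrable_const_bound[where B = 1])
    show "AE p in \<mu>. norm (t * fst p / (\<phi> + t * fst p)) \<le> 1"
      using LJSD_AE_nonneg(1)[OF L]
    proof eventually_elim
      case (elim p)
      then have "0 \<le> t * fst p" using that by simp
      then show ?case using \<open>0 < \<phi>\<close> by (simp add: divide_le_eq_1)
    qed
  qed measurable
  have int_fst: "integrable \<mu> (\<lambda>p. fst p)"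
  proof (rule integrable_const_bound[where B = C])
    show "AE p in \<mu>. norm (fst p) \<le> C"
      using C by eventually_elim auto
  qed measurable
  \<comment> \<open>Were \<open>C\<close> negative, the box carrying the mass would be empty, which
    is impossible for a probability measure.\<close>
  have C0: "0 \<le> C"
  proof -
    have "AE p in \<mu>. 0 \<le> C"
      using C by eventually_elim auto
    then show ?thesis by simp
  qed
  \<comment> \<open>The increment at \<open>l\<close> is \<open>l\<close> times this expression with
    \<open>l\<close> in place of \<open>C\<close>; the denominators are largest at
    \<open>l = C\<close>.\<close>
  define c where "c = (y - x) * \<phi> / ((\<phi> + x * C) * (\<phi> + y * C))"
  have "0 < c"
    using assms C0 by (auto simp: c_def intro!: divide_pos_pos mult_pos_pos add_pos_nonneg)
  have pt: "c * l \<le> y * l / (\<phi> + y * l) - x * l / (\<phi> + x * l)" if "0 \<le> l" "l \<le> C" for l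
  proof -
    have p: "0 < \<phi> + x * l" "0 < \<phi> + y * l"
      using assms that by (auto intro!: add_pos_nonneg)
    have "(\<phi> + x * l) * (\<phi> + y * l) \<le> (\<phi> + x * C) * (\<phi> + y * C)"
      using assms that C0 p by (intro mult_mono add_left_mono mult_left_mono) auto
    then have "c * l \<le> (y - x) * \<phi> / ((\<phi> + x * l) * (\<phi> + y * l)) * l"
      unfolding c_def using assms that p
      by (intro mult_right_mono frac_le) auto
    also have "\<dots> = y * l / (\<phi> + y * l) - x * l / (\<phi> + x * l)"
      using p by (simp add: divide_simps) (simp add: algebra_simps)
    finally show ?thesis .
  qed
  have "0 < c * mean_train \<mu>"
    using L \<open>0 < c\<close> by (simp add: LJSD_def)
  also have "\<dots> = (\<integral>p. c * fst p \<partial>\<mu>)"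
    by (simp add: mean_train_def)
  also have "\<dots> \<le> (\<integral>p. y * fst p / (\<phi> + y * fst p) - x * fst p / (\<phi> + x * fst p) \<partial>\<mu>)"
  proof (rule integral_mono_AE)
    show "AE p in \<mu>. c * fst p \<le> y * fst p / (\<phi> + y * fst p) - x * fst p / (\<phi> + x * fst p)"
      using C by eventually_elim (auto intro: pt)
  qed (use int[of x] int[of y] int_fst assms in auto)
  also have "\<dots> = (\<integral>p. y * fst p / (\<phi> + y * fst p) \<partial>\<mu>) - (\<integral>p. x * fst p / (\<phi> + x * fst p) \<partial>\<mu>)"
    using int[of x] int[of y] assms by simp
  finally have "(\<integral>p. x * fst p / (\<phi> + x * fst p) \<partial>\<mu>) < (\<integral>p. y * fst p / (\<phi> + y * fst p) \<partial>\<mu>)"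
    by simp
  moreover have "t * I_fun \<mu> \<phi> 1 1 t = \<phi> * (\<integral>p. t * fst p / (\<phi> + t * fst p) \<partial>\<mu>)" for t
    by (simp add: I_fun_def mult.left_commute flip: integral_mult_right_zero)
  ultimately show ?thesis
    using \<open>0 < \<phi>\<close> by simp
qed

text \<open>Cleared of its denominator, the root equation reads \<open>g t = 1\<close>, and
  \<open>g\<close> is strictly increasing on the positive reals: its \<omega> term is nondecreasing
  because \<omega> \<ge> 0, its other term strictly increasing.\<close>

lemma ridgeless_root_unique:
  assumes L: "LJSD \<mu>" and "0 < \<phi>" and \<omega>: "0 \<le> act_omega \<sigma> (mean_train \<mu>)"
    and "is_ridgeless_root \<mu> \<sigma> \<phi> x" "is_ridgeless_root \<mu> \<sigma> \<phi> y"
  shows "x = y"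
proof -
  define g where "g t = t * act_omega \<sigma> (mean_train \<mu>) + t * I_fun \<mu> \<phi> 1 1 t" for t
  have root: "0 < t \<and> g t = 1" if "is_ridgeless_root \<mu> \<sigma> \<phi> t" for t
  proof -
    define d where "d = act_omega \<sigma> (mean_train \<mu>) + I_fun \<mu> \<phi> 1 1 t"
    have t: "0 < t" "t = 1 / d"
      using that by (auto simp: is_ridgeless_root_def d_def)
    \<comment> \<open>Otherwise \<open>1 / d\<close> would take its default value 0, against
      \<open>0 < t\<close>.\<close>
    then have "d \<noteq> 0" by auto
    with t(2) have "t * d = 1" by simp
    then show ?thesis
      using t(1) by (simp add: g_def d_def distrib_left)
  qed
  have "g s < g t" if "0 < s" "s < t" for s t
    unfolding g_def
    by (intro add_le_less_mono mult_right_mono mult_I_fun_strict_mono[OF L \<open>0 < \<phi>\<close> that] \<omega> less_imp_le[OF that(2)])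
  then show ?thesis
    using root[OF assms(4)] root[OF assms(5)] by (metis less_irrefl linorder_neqE)
qed

section \<open>Monotonicity of the variance\<close>

theorem proposition5p4:
  fixes \<mu> :: "(real \<times> real) measure" and \<sigma> :: "real \<Rightarrow> real" and \<phi> v :: real
  assumes "LJSD \<mu>"
    and "admissible_activation \<sigma>"
    and "0 < \<phi>" and "0 \<le> v"
    and "act_zeta \<sigma> (mean_train \<mu>) \<noteq> 0" and "act_zeta \<sigma> (mean_test \<mu>) \<noteq> 0"
    and "\<exists>x. is_ridgeless_root \<mu> \<sigma> \<phi> x"
  shows "\<forall>\<psi>\<^sub>1\<in>{0<..<\<phi>}. \<forall>\<psi>\<^sub>2\<in>{0<..<\<phi>}. \<phi> / \<psi>\<^sub>1 \<le> \<phi> / \<psi>\<^sub>2 \<longrightarrow>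
           V_ridgeless \<mu> \<sigma> v \<phi> \<psi>\<^sub>2 \<le> V_ridgeless \<mu> \<sigma> v \<phi> \<psi>\<^sub>1"
proof (intro ballI impI)
  fix \<psi>\<^sub>1 \<psi>\<^sub>2
  assume \<psi>: "\<psi>\<^sub>1 \<in> {0<..<\<phi>}" "\<psi>\<^sub>2 \<in> {0<..<\<phi>}" and "\<phi> / \<psi>\<^sub>1 \<le> \<phi> / \<psi>\<^sub>2"
  then have "\<psi>\<^sub>2 \<le> \<psi>\<^sub>1"
    by (simp add: field_simps)
  \<comment> \<open>Passing from \<open>\<psi>\<^sub>2\<close> to the larger
    \<open>\<psi>\<^sub>1\<close> raises the numerator and lowers the positive denominator.\<close>
  then have ratio: "\<psi>\<^sub>2 / (\<phi> - \<psi>\<^sub>2) \<le> \<psi>\<^sub>1 / (\<phi> - \<psi>\<^sub>1)"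
    using \<psi> by (intro frac_le) auto
  have means: "0 < mean_train \<mu>" "0 < mean_test \<mu>"
    using assms(1) by (auto simp: LJSD_def)
  \<comment> \<open>The training value serves the uniqueness of the root, the test value the sign of
    the slope.\<close>
  have \<omega>: "0 \<le> act_omega \<sigma> (mean_train \<mu>)" and \<omega>s: "0 \<le> act_omega \<sigma> (mean_test \<mu>)"
    using act_omega_nonneg means assms by auto
  define x where "x = ridgeless_root \<mu> \<sigma> \<phi>"
  have "\<exists>!x. is_ridgeless_root \<mu> \<sigma> \<phi> x"
    using assms(7) ridgeless_root_unique[OF assms(1,3) \<omega>] by blast
  then have "is_ridgeless_root \<mu> \<sigma> \<phi> x"
    unfolding x_def ridgeless_root_def by (rule theI')
  then have "0 < x"
    by (simp add: is_ridgeless_root_def)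
  \<comment> \<open>Up to the factor \<open>(act_xi \<sigma> \<mu>)\<^sup>2\<close>, this is the
    slope of the variance in \<open>\<psi> / (\<phi> - \<psi>)\<close>.\<close>
  define K where "K = x * (v + I_fun \<mu> \<phi> 1 1 x) * (act_omega \<sigma> (mean_test \<mu>) + I_star \<mu> \<phi> 1 1 x)"
  have "0 \<le> K"
    unfolding K_def using \<open>0 < x\<close> assms(4) \<omega>s I_fun_nonneg[OF assms(1,3) \<open>0 < x\<close>] I_star_nonneg[OF assms(1,3) \<open>0 < x\<close>]
    by (intro mult_nonneg_nonneg add_nonneg_nonneg) auto
  then have "(act_xi \<sigma> \<mu>)\<^sup>2 * (\<psi>\<^sub>2 / (\<phi> - \<psi>\<^sub>2)) * K \<le> (act_xi \<sigma> \<mu>)\<^sup>2 * (\<psi>\<^sub>1 / (\<phi> - \<psi>\<^sub>1)) * K"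
    by (intro mult_right_mono mult_left_mono ratio) auto
  \<comment> \<open>The second summand of the variance is free of \<psi>, hence the same on both
    sides.\<close>
  then show "V_ridgeless \<mu> \<sigma> v \<phi> \<psi>\<^sub>2 \<le> V_ridgeless \<mu> \<sigma> v \<phi> \<psi>\<^sub>1"
    unfolding V_ridgeless_def Let_def K_def x_def mult.assoc by (rule add_right_mono)
qed

end
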